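(* For every $m\ge 2$, the following program returns $G=R_m$: set $G=[\ ]$; for $c=1$ to $2^{m-1}-1$, let $v=v_2(c)$, let $h$ be the Hamming weight of $c$ (number of ones in its binary expansion), set $d=m-v-h$, and append $[d,d+1,\ldots,d+v]$ to $G$; return $G$.
   Context: $v_2(c)$ denotes the largest integer $v$ such that $2^v$ divides $c$. The sequences $R_m$ are defined by $R_2=[1]$ and $R_m=(R_{m-1}+1)\cup[1,2,\ldots,m-1]\cup R_{m-1}$ for $m\ge3$, where $\cup$ is concatenation and $R_{m-1}+1$ adds $1$ to each entry. *)

theory Defs
  imports "HOL-Computational_Algebra.Computational_Algebra"
begin

text \<open>Entries are integers, so that no subtraction is truncated. The sequences are only
  defined for \<open>m \<ge> 2\<close>; the empty list for \<open>m < 2\<close> is a filler value.\<close>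

fun R :: "nat \<Rightarrow> int list" where
  "R m = (if m = 2 then [1]
          else if m \<ge> 3 then map (\<lambda>x. x + 1) (R (m - 1)) @ [1..int m - 1] @ R (m - 1)
          else [])"

(* The equation is unconditional, hence looping as a rewrite rule. *)
declare R.simps [simp del]

definition hamming_weight :: "nat \<Rightarrow> nat" where
  "hamming_weight c = card {i. bit c i}"

text \<open>The loop body, as a transformer of the variable \<open>G\<close>. The valuation \<open>v\<^sub>2(c)\<close> is
  \<open>multiplicity 2 c\<close>; it is only used for \<open>c > 0\<close>.\<close>

definition loop_body :: "nat \<Rightarrow> nat \<Rightarrow> int list \<Rightarrow> int list" where
  "loop_body m c G =
     (let v = multiplicity 2 c;
          h = hamming_weight c;
          d = int m - int v - int h
      in G @ [d..d + int v])"

definition program :: "nat \<Rightarrow> int list" where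
  "program m = fold (loop_body m) [1..<2 ^ (m - 1)] []"

end

theory Submission
  imports Defs
begin

text \<open>The block appended for the counter \<open>c\<close> depends only on \<open>m\<close>, \<open>v\<^sub>2(c)\<close> and the Hamming
  weight of \<open>c\<close>. Passing from \<open>m\<close> to \<open>m + 1\<close>, the counters below \<open>2 ^ (m - 1)\<close> give their old
  blocks shifted by one, the counter \<open>2 ^ (m - 1)\<close> gives \<open>[1..m]\<close>, and adding \<open>2 ^ (m - 1)\<close> to a
  smaller positive counter keeps the valuation and raises the weight by one, which cancels the
  increase of \<open>m\<close>.\<close>

definition block :: "nat \<Rightarrow> nat \<Rightarrow> int list" where
  "block m c =
     [int m - int (multiplicity 2 c) - int (hamming_weight c)..int m - int (hamming_weight c)]"

lemma program_eq_concat: "program m = concat (map (block m) [1..<2 ^ (m - 1)])"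
proof -
  have "loop_body m = (\<lambda>c G. G @ block m c)"
    by (simp add: fun_eq_iff loop_body_def block_def Let_def)
  then have "fold (loop_body m) cs G = G @ concat (map (block m) cs)" for cs G
    by (induction cs arbitrary: G) auto
  then show ?thesis
    by (simp add: program_def)
qed

text \<open>Bit \<open>n\<close> of \<open>c\<close> is clear, so the addition produces no carry and
  is a bitwise or.\<close>

lemma bit_add_power:
  fixes c :: nat
  assumes "c < 2 ^ n"
  shows "bit (2 ^ n + c) i \<longleftrightarrow> i = n \<or> bit c i"
proof -
  have "take_bit n c = c"
    using assms by (simp add: take_bit_nat_eq_self)
  then have "\<not> bit c n"
    by (metis bit_take_bit_iff less_irrefl)
  then have "2 ^ n + c = or (2 ^ n) c"
    by (intro disjunctive_add_eq_or bit_eqI) (auto simp: bit_and_iff bit_exp_iff)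
  then show ?thesis
    by (auto simp: bit_or_iff bit_exp_iff)
qed

lemma hamming_weight_add_power:
  assumes "c < 2 ^ n"
  shows "hamming_weight (2 ^ n + c) = Suc (hamming_weight c)"
proof -
  have "take_bit n c = c"
    using assms by (simp add: take_bit_nat_eq_self)
  then have sub: "{i. bit c i} \<subseteq> {..<n}"
    by (metis (mono_tags) bit_take_bit_iff lessThan_iff mem_Collect_eq subsetI)
  have "{i. bit (2 ^ n + c) i} = insert n {i. bit c i}"
    using bit_add_power[OF assms] by auto
  moreover have "finite {i. bit c i}" "n \<notin> {i. bit c i}"
    using sub finite_subset by blast+
  ultimately show ?thesis
    by (simp add: hamming_weight_def)
qed

text \<open>When two summands have different valuations, the smaller one is that of the sum; here
  \<open>c\<close> has valuation below \<open>n\<close>, because a positive \<open>c\<close> is at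
  least any power of 2 dividing it.\<close>

lemma multiplicity_add_power:
  fixes c :: nat
  assumes "0 < c" "c < 2 ^ n"
  shows "multiplicity 2 (2 ^ n + c) = multiplicity 2 c"
proof -
  have "2 ^ multiplicity 2 c \<le> c"
    using assms by (intro dvd_imp_le multiplicity_dvd) auto
  then have "(2::nat) ^ multiplicity 2 c < 2 ^ n"
    using assms by linarith
  then have "multiplicity 2 c < n"
    by simp
  moreover have "multiplicity 2 ((2::nat) ^ n) = n"
    by (simp add: multiplicity_same_power)
  ultimately show ?thesis
    using assms multiplicity_sum_lt[of 2 c "2 ^ n"] by (simp add: add.commute)
qed

lemma block_Suc: "block (Suc m) c = map (\<lambda>x. x + 1) (block m c)"
proof -
  have "map (\<lambda>x. x + 1) [a..b] = [a + 1..b + 1]" for a b :: int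
    by (induction a b rule: upto.induct) (subst (1 2) upto.simps, simp)
  then show ?thesis
    by (simp add: block_def algebra_simps)
qed

lemma program_Suc:
  assumes "m \<ge> 1"
  shows "program (Suc m) = map (\<lambda>x. x + 1) (program m) @ [1..int m] @ program m"
proof -
  obtain n where m: "m = Suc n"
    using assms by (cases m) auto
  have lower: "program m = concat (map (block m) [1..<2 ^ n])"
    by (simp add: program_eq_concat m)
  have weight: "hamming_weight (2 ^ n) = 1"
    using hamming_weight_add_power[of 0 n] by (simp add: hamming_weight_def)
  \<comment> \<open>Here v = n and h = 1, so d = (n + 2) - n - 1 = 1 and d + v = n + 1 = m.\<close>
  have middle: "block (Suc m) (2 ^ n) = [1..int m]"
    by (simp add: block_def weight m multiplicity_same_power)
  have upper: "block (Suc m) (c + 2 ^ n) = block m c" if "c \<in> {1..<2 ^ n}" for c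
    using that multiplicity_add_power[of c n] hamming_weight_add_power[of c n]
    by (simp add: block_def algebra_simps)
  \<comment> \<open>The counters are split by their top bit, with \<open>2 ^ n\<close> itself set
    apart because its lower part 0 has no valuation.\<close>
  have "[1..<2 ^ m] = [1..<2 ^ n] @ [2 ^ n] @ [Suc (2 ^ n)..<2 ^ n + 2 ^ n]"
    using upt_add_eq_append[of 1 "2 ^ n" "2 ^ n"] by (simp add: m mult_2 upt_rec[of "2 ^ n"])
  also have "[Suc (2 ^ n)..<2 ^ n + 2 ^ n] = map (\<lambda>c. c + 2 ^ n) [1..<2 ^ n]"
    by (rule nth_equalityI) auto
  finally have "program (Suc m) = concat (map (block (Suc m)) [1..<2 ^ n])
      @ block (Suc m) (2 ^ n) @ concat (map (\<lambda>c. block (Suc m) (c + 2 ^ n)) [1..<2 ^ n])"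
    by (simp add: program_eq_concat comp_def)
  also have "map (\<lambda>c. block (Suc m) (c + 2 ^ n)) [1..<2 ^ n] = map (block m) [1..<2 ^ n]"
    using upper by simp
  finally show ?thesis
    unfolding middle by (simp add: lower block_Suc[of m] map_concat comp_def)
qed

theorem theorem4p1:
  fixes m :: nat
  assumes "m \<ge> 2"
  shows "program m = R m"
  using assms
proof (induction m rule: dec_induct)
  case base
  \<comment> \<open>The recursion for \<open>program\<close> already holds from 1 to 2, where both
    outer parts are empty and the middle is [1].\<close>
  have "program 1 = []"
    by (simp add: program_def)
  then show ?case
    using program_Suc[of 1] by (simp add: R.simps flip: numeral_2_eq_2)
next
  case (step m)
  then show ?case
    using program_Suc[of m] by (simp add: R.simps[of "Suc m"])
qed

end
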